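(* There exists $L>0$ such that the following holds. Consider any $0<p<1$, any finite set $X$ and any collection $\Lambda$ of sequences $\lambda=(\lambda_i)_{i\in X}$ with $\lambda_i\ge 0$. Then the family $$\left\{S\subseteq X:\ \sup_{\lambda\in\Lambda}\sum_{i\in S}\lambda_i\ \ge\ L\,\mathbb{E}\sup_{\lambda\in\Lambda}\sum_{i\in X_p}\lambda_i\right\}$$ is $p$-small.
   Context: For a finite set $X$ write $2^X$ for its power set. For $p\in[0,1]$, $X_p$ denotes the random subset of $X$ with distribution $\mu_p(A)=p^{|A|}(1-p)^{|X\setminus A|}$ for $A\subseteq X$. For $S\subseteq X$ let $\langle S\rangle=\{T\subseteq X: T\supseteq S\}$. A family $\mathcal{F}\subseteq 2^X$ is called $p$-small if there is $\mathcal{G}\subseteq 2^X$ such that $\mathcal{F}\subseteq\bigcup_{S\in\mathcal{G}}\langle S\rangle$ and $\sum_{S\in\mathcal{G}}p^{|S|}\le 1/2$.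
   Formalization: The expected supremum is assumed positive and finite: if it is 0 the family contains the empty set and is never p-small, and if infinite the claim can fail (one point, p>1/2, unbounded Λ). X ranges over finite subsets of one arbitrary ground type; the naturals cover all finite sets. *)

theory Defs
  imports "HOL-Probability.Probability"
begin

definition random_subset :: "real \<Rightarrow> 'a set \<Rightarrow> 'a set measure" where
  "random_subset p X =
     point_measure (Pow X) (\<lambda>A. ennreal (p ^ card A * (1 - p) ^ card (X - A)))"

definition upset :: "'a set \<Rightarrow> 'a set \<Rightarrow> 'a set set" where
  "upset X S = {T. T \<subseteq> X \<and> S \<subseteq> T}"

definition p_small :: "real \<Rightarrow> 'a set \<Rightarrow> 'a set set \<Rightarrow> bool" where
  "p_small p X F \<longleftrightarrow>
     (\<exists>G. G \<subseteq> Pow X \<and> F \<subseteq> (\<Union>S\<in>G. upset X S) \<and> (\<Sum>S\<in>G. p ^ card S) \<le> 1 / 2)"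

text \<open>The supremum is taken in the extended nonnegative reals, so that no boundedness of the
  collection is needed for it to be meaningful. A sequence indexed by \<open>X\<close> is a function of which
  only the values on \<open>X\<close> matter; these are nonnegative in every use below, so the coercion
  \<^const>\<open>ennreal\<close> does not truncate.\<close>

definition selector_sup :: "('a \<Rightarrow> real) set \<Rightarrow> 'a set \<Rightarrow> ennreal" where
  "selector_sup \<Lambda> S = (SUP l\<in>\<Lambda>. ennreal (\<Sum>i\<in>S. l i))"

definition expected_sup :: "real \<Rightarrow> 'a set \<Rightarrow> ('a \<Rightarrow> real) set \<Rightarrow> ennreal" where
  "expected_sup p X \<Lambda> = (\<integral>\<^sup>+ S. selector_sup \<Lambda> S \<partial>random_subset p X)"

lemma prob_space_random_subset:
  assumes "finite X" "0 \<le> p" "p \<le> 1"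
  shows "prob_space (random_subset p X)"
proof
  have "emeasure (random_subset p X) (Pow X)
      = (\<Sum>A\<in>Pow X. ennreal (p ^ card A * (1 - p) ^ card (X - A)))"
    unfolding random_subset_def using assms by (intro emeasure_point_measure_finite) auto
  also have "\<dots> = ennreal (\<Sum>A\<in>Pow X. p ^ card A * (1 - p) ^ card (X - A))"
    using assms by (intro sum_ennreal) auto
  also have "(\<Sum>A\<in>Pow X. p ^ card A * (1 - p) ^ card (X - A)) = (\<Prod>i\<in>X. p + (1 - p))"
    using assms(1) by (subst prod_add) simp_all
  finally show "emeasure (random_subset p X) (space (random_subset p X)) = 1"
    by (simp add: random_subset_def space_point_measure)
qed

end

theory Submission
  imports Defs
begin

text \<open>
  Rescale so that every \<open>S\<close> in the family has a witness \<open>l\<close> of weight \<open>l(S) \<ge> m\<close>, and call \<open>W\<close>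
  failing if \<open>l(W) < m / 2\<close> for all witnesses. For a failing \<open>W\<close> and a set \<open>S\<close> of the family, pick
  a fragment \<open>T \<subseteq> S - W\<close>, of least size among those maximising over \<open>l\<close> and \<open>T\<close> the quantity
  \<open>l(W \<union> T)\<close> minus half the sum of the \<open>2|T|\<close> largest values of \<open>l\<close> on \<open>W \<union> T\<close>.
  Discarding \<open>u\<close> elements of \<open>T\<close> ranked below \<open>2|T|\<close> would cost at most \<open>u\<close> times the
  \<open>2|T|\<close>-th largest value, and the halved top sum would decrease by at least as much; hence \<open>T\<close> lies
  among the \<open>2|T|\<close> top elements of \<open>Z = W \<union> T\<close> for an \<open>l\<close> that depends on \<open>Z\<close> and \<open>|T|\<close> only. So
  at most \<open>4\<^sup>t\<close> fragments of size \<open>t\<close> are compatible with a given \<open>Z\<close>, and for \<open>W\<close> random of density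
  \<open>q = min 1 (20 p)\<close> the expected weight of the cover by fragments is at most \<open>1/4\<close>. If the family is
  not \<open>p\<close>-small, \<open>W\<close> is therefore failing with probability at most \<open>1/2\<close>, so that the expected
  supremum over \<open>X\<^sub>q\<close> is at least \<open>m / 4\<close>. Thinning \<open>X\<^sub>q\<close> to \<open>X\<^sub>p\<close> costs a factor \<open>q / p \<le> 20\<close>.
\<close>

section \<open>Product weights on subsets and thinning\<close>

definition subset_weight :: "real \<Rightarrow> 'a set \<Rightarrow> 'a set \<Rightarrow> real" where
  "subset_weight p X A = p ^ card A * (1 - p) ^ card (X - A)"

lemma subset_weight_nonneg: "0 \<le> p \<Longrightarrow> p \<le> 1 \<Longrightarrow> 0 \<le> subset_weight p X A"
  by (simp add: subset_weight_def)

lemma sum_Pow_powers: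
  fixes a b :: "'b::comm_semiring_1"
  assumes "finite X"
  shows "(\<Sum>A\<in>Pow X. a ^ card A * b ^ card (X - A)) = (a + b) ^ card X"
proof -
  have "(\<Prod>i\<in>X. a + b) = (\<Sum>A\<in>Pow X. a ^ card A * b ^ card (X - A))"
    using assms by (subst prod_add) simp_all
  then show ?thesis by simp
qed

lemma sum_subset_weight: "finite X \<Longrightarrow> (\<Sum>A\<in>Pow X. subset_weight p X A) = 1"
  by (simp add: subset_weight_def sum_Pow_powers)

lemma subset_weight_expectation_sum:
  assumes "finite X"
  shows "(\<Sum>A\<in>Pow X. subset_weight p X A * sum l A) = p * sum l X"
  using assms
proof (induction X)
  case (insert x X)
  have fin: "finite A" if "A \<in> Pow X" for A
    using that insert.hyps by (auto intro: finite_subset)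
  have notin: "x \<notin> A" if "A \<in> Pow X" for A
    using that insert.hyps by auto
  have without_x: "subset_weight p (insert x X) A = (1 - p) * subset_weight p X A" if "A \<in> Pow X" for A
    using insert.hyps notin[OF that] fin[OF that]
    by (simp add: subset_weight_def insert_Diff_if)
  have with_x: "subset_weight p (insert x X) (insert x A) = p * subset_weight p X A" if "A \<in> Pow X" for A
  proof -
    have "insert x X - insert x A = X - A"
      using insert.hyps by auto
    then show ?thesis
      using notin[OF that] fin[OF that] by (simp add: subset_weight_def)
  qed
  have "(\<Sum>A\<in>Pow (insert x X). subset_weight p (insert x X) A * sum l A)
      = (\<Sum>A\<in>Pow X. subset_weight p (insert x X) A * sum l A)
        + (\<Sum>A\<in>insert x ` Pow X. subset_weight p (insert x X) A * sum l A)"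
    unfolding Pow_insert using insert.hyps by (intro sum.union_disjoint) auto
  also have "(\<Sum>A\<in>insert x ` Pow X. subset_weight p (insert x X) A * sum l A)
      = (\<Sum>A\<in>Pow X. subset_weight p (insert x X) (insert x A) * sum l (insert x A))"
    using insert.hyps by (subst sum.reindex) (auto simp: inj_on_def)
  also have "\<dots> = (\<Sum>A\<in>Pow X. p * l x * subset_weight p X A + p * (subset_weight p X A * sum l A))"
    using fin notin by (intro sum.cong refl) (simp add: with_x algebra_simps)
  also have "\<dots> = p * l x + p * (p * sum l X)"
    using insert by (simp add: sum.distrib sum_distrib_left[symmetric] sum_subset_weight)
  also have "(\<Sum>A\<in>Pow X. subset_weight p (insert x X) A * sum l A)
      = (\<Sum>A\<in>Pow X. (1 - p) * (subset_weight p X A * sum l A))"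
    by (intro sum.cong refl) (simp add: without_x)
  also have "\<dots> = (1 - p) * (p * sum l X)"
    using insert by (simp add: sum_distrib_left[symmetric])
  finally show ?case
    using insert.hyps by (simp add: algebra_simps)
qed simp

text \<open>With \<open>W = A \<union> B\<close>, a point outside \<open>A\<close> is either chosen
  and then dropped, so in \<open>B\<close>, or never chosen; the binomial theorem over
  \<open>B\<close> adds these probabilities to \<open>1 - q * r\<close>.\<close>

lemma subset_weight_thinning:
  assumes "finite X" "A \<subseteq> X"
  shows "(\<Sum>W | A \<subseteq> W \<and> W \<subseteq> X. subset_weight q X W * subset_weight r W A)
       = subset_weight (q * r) X A"
proof -
  have finA: "finite A"
    using assms by (rule finite_subset[rotated])
  have "(\<Sum>W | A \<subseteq> W \<and> W \<subseteq> X. subset_weight q X W * subset_weight r W A)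
      = (\<Sum>B\<in>Pow (X - A). subset_weight q X (A \<union> B) * subset_weight r (A \<union> B) A)"
    by (rule sum.reindex_bij_witness[of _ "\<lambda>B. A \<union> B" "\<lambda>W. W - A"])
       (use assms in \<open>auto simp: Un_absorb1\<close>)
  also have "\<dots> = (\<Sum>B\<in>Pow (X - A). (q * r) ^ card A *
                    ((q * (1 - r)) ^ card B * (1 - q) ^ card (X - A - B)))"
  proof (intro sum.cong refl)
    fix B assume B: "B \<in> Pow (X - A)"
    then have "finite B" "A \<inter> B = {}"
      using assms by (auto intro: finite_subset)
    then have c: "card (A \<union> B) = card A + card B"
      using finA by (simp add: card_Un_disjoint)
    have "A \<union> B - A = B" "X - (A \<union> B) = X - A - B"
      using B by auto
    then show "subset_weight q X (A \<union> B) * subset_weight r (A \<union> B) A = (q * r) ^ card A *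
        ((q * (1 - r)) ^ card B * (1 - q) ^ card (X - A - B))"
      by (simp add: subset_weight_def c power_add power_mult_distrib)
  qed
  also have "\<dots> = (q * r) ^ card A * (q * (1 - r) + (1 - q)) ^ card (X - A)"
    using assms by (simp add: sum_distrib_left[symmetric] sum_Pow_powers)
  also have "q * (1 - r) + (1 - q) = 1 - q * r"
    by (simp add: algebra_simps)
  finally show ?thesis
    by (simp add: subset_weight_def)
qed

text \<open>Jensen's inequality for a maximum of linear functionals: the \<open>l\<close> attaining
  \<open>f W\<close> has mean \<open>r * f W\<close> over the thinned subset of \<open>W\<close>,
  and \<open>f\<close> dominates it there. It remains to average over \<open>W\<close>.\<close>

lemma thinning_expectation_Max:
  assumes "finite X" "finite \<Lambda>" "\<Lambda> \<noteq> {}" "0 \<le> q" "q \<le> 1" "0 \<le> r" "r \<le> 1"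
  defines "f \<equiv> \<lambda>S. Max ((\<lambda>l. sum l S) ` \<Lambda>)"
  shows "r * (\<Sum>W\<in>Pow X. subset_weight q X W * f W)
       \<le> (\<Sum>A\<in>Pow X. subset_weight (q * r) X A * f A)"
proof -
  have mean: "r * f W \<le> (\<Sum>A\<in>Pow W. subset_weight r W A * f A)" if "W \<in> Pow X" for W
  proof -
    have "f W \<in> (\<lambda>l. sum l W) ` \<Lambda>"
      unfolding f_def using assms by (intro Max_in) auto
    then obtain l where l: "l \<in> \<Lambda>" "f W = sum l W"
      by auto
    have "r * f W = (\<Sum>A\<in>Pow W. subset_weight r W A * sum l A)"
      using that assms(1) l by (subst subset_weight_expectation_sum) (auto intro: finite_subset)
    also have "\<dots> \<le> (\<Sum>A\<in>Pow W. subset_weight r W A * f A)"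
      unfolding f_def using l assms
      by (intro sum_mono mult_left_mono Max_ge subset_weight_nonneg) auto
    finally show ?thesis .
  qed
  have "r * (\<Sum>W\<in>Pow X. subset_weight q X W * f W)
      = (\<Sum>W\<in>Pow X. subset_weight q X W * (r * f W))"
    by (simp add: sum_distrib_left algebra_simps)
  also have "\<dots> \<le> (\<Sum>W\<in>Pow X. subset_weight q X W * (\<Sum>A\<in>Pow W. subset_weight r W A * f A))"
    using assms mean by (intro sum_mono mult_left_mono subset_weight_nonneg) auto
  also have "\<dots> = (\<Sum>W\<in>Pow X. \<Sum>A | A \<in> Pow X \<and> A \<subseteq> W.
                      subset_weight q X W * subset_weight r W A * f A)"
    unfolding sum_distrib_left mult.assoc by (intro sum.cong refl) auto
  also have "\<dots> = (\<Sum>A\<in>Pow X. \<Sum>W | W \<in> Pow X \<and> A \<subseteq> W.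
                      subset_weight q X W * subset_weight r W A * f A)"
    using assms by (intro sum.swap_restrict) auto
  also have "\<dots> = (\<Sum>A\<in>Pow X. subset_weight (q * r) X A * f A)"
  proof (intro sum.cong refl)
    fix A assume "A \<in> Pow X"
    then show "(\<Sum>W | W \<in> Pow X \<and> A \<subseteq> W. subset_weight q X W * subset_weight r W A * f A)
        = subset_weight (q * r) X A * f A"
      using subset_weight_thinning[OF assms(1), of A q r]
      by (simp add: sum_distrib_right[symmetric] conj_commute)
  qed
  finally show ?thesis .
qed

section \<open>Top elements and the choice of fragments\<close>

lemma exists_top_elements:
  fixes f :: "'a \<Rightarrow> 'b::linorder"
  assumes "finite Z"
  shows "\<exists>Q\<subseteq>Z. card Q = min k (card Z) \<and> (\<forall>x\<in>Q. \<forall>y\<in>Z - Q. f y \<le> f x)"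
proof (induction k)
  case (Suc k)
  then obtain Q where Q: "Q \<subseteq> Z" "card Q = min k (card Z)" "\<forall>x\<in>Q. \<forall>y\<in>Z - Q. f y \<le> f x"
    by blast
  show ?case
  proof (cases "Q = Z")
    case True
    then show ?thesis using Q by (intro exI[of _ Q]) auto
  next
    case False
    have finQ: "finite Q"
      using Q assms by (auto intro: finite_subset)
    have "card Q < card Z"
      using Q(1) False assms by (intro psubset_card_mono) auto
    have "Max (f ` (Z - Q)) \<in> f ` (Z - Q)"
      using assms Q False by (intro Max_in) auto
    then obtain x where x: "x \<in> Z - Q" "f x = Max (f ` (Z - Q))"
      by auto
    have "f y \<le> f x" if "y \<in> Z - Q" for y
      using that assms x by auto
    then show ?thesis
      using Q x finQ \<open>card Q < card Z\<close> by (intro exI[of _ "insert x Q"]) auto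
  qed
qed (auto intro!: exI[of _ "{}"])

text \<open>Measure values by their excess over the threshold \<open>z\<close>: it is nonnegative on
  \<open>Q\<close> and nonpositive off \<open>Q\<close>, so no subset of \<open>Z\<close> has a
  larger total excess than \<open>Q\<close>. For \<open>k \<le> card Q\<close>, a set of at most
  \<open>k\<close> elements thus falls short of the top sum by at least \<open>z\<close> per missing
  element.\<close>

lemma sum_le_top_sum:
  fixes l :: "'a \<Rightarrow> real"
  assumes "finite Z" "A \<subseteq> Z" "Q \<subseteq> Z" "card A \<le> k" "0 \<le> z"
    and "\<And>x. x \<in> Q \<Longrightarrow> z \<le> l x" "\<And>y. y \<in> Z - Q \<Longrightarrow> l y \<le> z"
  shows "sum l A \<le> sum l Q - (real (card Q) - real k) * z"
proof -
  have fin: "finite A" "finite Q"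
    using assms by (auto intro: finite_subset)
  have "(\<Sum>x\<in>A. l x - z) = (\<Sum>x\<in>A \<inter> Q. l x - z) + (\<Sum>x\<in>A - Q. l x - z)"
    using fin by (subst sum.Int_Diff[of _ _ Q]) auto
  also have "\<dots> \<le> (\<Sum>x\<in>Q. l x - z) + 0"
    using assms fin by (intro add_mono sum_mono2 sum_nonpos) auto
  finally have "sum l A - real (card A) * z \<le> sum l Q - real (card Q) * z"
    by (simp add: sum_subtractf)
  moreover have "real (card A) * z \<le> real k * z"
    using assms by (intro mult_right_mono) auto
  ultimately show ?thesis
    by (simp add: algebra_simps)
qed

text \<open>The order of quantifiers matters: \<open>Q\<close> is fixed before \<open>W\<close> and
  \<open>S\<close>, so fragments can be counted from \<open>Z = W \<union> T\<close> and
  \<open>card T\<close> alone. Nonemptiness matters too, since an empty fragment would cost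
  \<open>p ^ 0 = 1\<close>.\<close>

lemma fragments_in_small_sets:
  fixes \<Lambda> :: "('a \<Rightarrow> real) set"
  assumes "finite X" "finite \<Lambda>" "\<And>l i. l \<in> \<Lambda> \<Longrightarrow> i \<in> X \<Longrightarrow> 0 \<le> l i"
    and "F \<subseteq> Pow X" "\<And>S. S \<in> F \<Longrightarrow> \<exists>l\<in>\<Lambda>. m \<le> sum l S"
  shows "\<exists>Q. (\<forall>Z\<subseteq>X. \<forall>t. finite (Q Z t) \<and> card (Q Z t) \<le> 2 * t) \<and>
    (\<forall>W\<subseteq>X. (\<forall>l\<in>\<Lambda>. sum l W < m / 2) \<longrightarrow>
      (\<forall>S\<in>F. \<exists>T. T \<subseteq> S - W \<and> T \<noteq> {} \<and> T \<subseteq> Q (W \<union> T) (card T)))"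
proof (cases "\<Lambda> = {}")
  case True
  then have "F = {}"
    using assms(5) by auto
  then show ?thesis
    by (intro exI[of _ "\<lambda>_ _. {}"]) auto
next
  case False
  define top where "top l Z k Q \<longleftrightarrow>
      Q \<subseteq> Z \<and> card Q = min k (card Z) \<and> (\<forall>x\<in>Q. \<forall>y\<in>Z - Q. l y \<le> l x)"
    for l :: "'a \<Rightarrow> real" and Z k Q
  \<comment> \<open>Fixing one choice among ties makes the top set a function of \<open>l\<close>,
    \<open>Z\<close> and \<open>k\<close>.\<close>
  define Top where "Top l Z k = (SOME Q. top l Z k Q)" for l Z k
  have "top l Z k (Top l Z k)" if "finite Z" for l Z k
    unfolding Top_def top_def using exists_top_elements[OF that, of k l] by (rule someI_ex)
  then have Top: "\<And>l Z k. finite Z \<Longrightarrow> Top l Z k \<subseteq> Z"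
      "\<And>l Z k. finite Z \<Longrightarrow> card (Top l Z k) = min k (card Z)"
      "\<And>l Z k x y. finite Z \<Longrightarrow> x \<in> Top l Z k \<Longrightarrow> y \<in> Z - Top l Z k \<Longrightarrow> l y \<le> l x"
    by (simp_all add: top_def)
  have finTop: "finite (Top l Z k)" if "finite Z" for l Z k
    using Top(1)[OF that] that by (rule finite_subset)
  \<comment> \<open>The \<open>2\<close> and the half balance: lowering \<open>t\<close> by
    \<open>u\<close> takes \<open>2 * u\<close> values out of the top sum, half of which count,
    against \<open>u\<close> elements lost from \<open>Z\<close>.\<close>
  define gain where "gain l Z t = sum l Z - sum l (Top l Z (2 * t)) / 2" for l Z t
  have "\<exists>l\<in>\<Lambda>. \<forall>l'\<in>\<Lambda>. gain l' Z t \<le> gain l Z t" for Z t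
  proof -
    have "Max ((\<lambda>l. gain l Z t) ` \<Lambda>) \<in> (\<lambda>l. gain l Z t) ` \<Lambda>"
      using assms False by (intro Max_in) auto
    then obtain l where "l \<in> \<Lambda>" "gain l Z t = Max ((\<lambda>l. gain l Z t) ` \<Lambda>)"
      by auto
    then show ?thesis
      using assms by (intro bexI[of _ l]) auto
  qed
  then obtain best where best: "\<And>Z t. best Z t \<in> \<Lambda>"
      "\<And>Z t l. l \<in> \<Lambda> \<Longrightarrow> gain l Z t \<le> gain (best Z t) Z t"
    by metis
  define Q where "Q Z t = Top (best Z t) Z (2 * t)" for Z t
  show ?thesis
  proof (intro exI[of _ Q] conjI allI impI ballI)
    fix Z t assume "Z \<subseteq> X"
    then have "finite Z"
      using assms by (auto intro: finite_subset)
    then show "finite (Q Z t)" "card (Q Z t) \<le> 2 * t"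
      unfolding Q_def using Top(2) finTop by simp_all
  next
    fix W S
    assume W: "W \<subseteq> X" "\<forall>l\<in>\<Lambda>. sum l W < m / 2" and S: "S \<in> F"
    have finS: "finite S" "finite W" "S \<subseteq> X"
      using assms(1,4) W S finite_subset by blast+
    define P where "P = \<Lambda> \<times> Pow (S - W)"
    define g where "g = (\<lambda>(l, T). gain l (W \<union> T) (card T))"
    have P: "finite P" "P \<noteq> {}"
      using assms finS False by (auto simp: P_def)
    define M where "M = Max (g ` P)"
    have "M \<in> g ` P"
      unfolding M_def using P by (intro Max_in) auto
    then obtain lT where lT: "lT \<in> P \<and> g lT = M"
        "\<And>lT'. lT' \<in> P \<and> g lT' = M \<Longrightarrow> card (snd lT) \<le> card (snd lT')"
      using ex_has_least_nat[of "\<lambda>lT. lT \<in> P \<and> g lT = M" _ "\<lambda>lT. card (snd lT)"] by blast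
    define T where "T = snd lT"
    have T: "T \<subseteq> S - W"
      using lT by (auto simp: P_def T_def)
    have le_M: "gain l (W \<union> T') (card T') \<le> M" if "l \<in> \<Lambda>" "T' \<subseteq> S - W" for l T'
    proof -
      have "g (l, T') \<le> M"
        unfolding M_def using P that by (intro Max_ge) (auto simp: P_def)
      then show ?thesis by (simp add: g_def)
    qed
    have least: "card T \<le> card T'"
      if "l \<in> \<Lambda>" "T' \<subseteq> S - W" "M \<le> gain l (W \<union> T') (card T')" for l T'
      using that lT(2)[of "(l, T')"] le_M[of l T'] by (auto simp: P_def g_def T_def)
    have fst: "fst lT \<in> \<Lambda>" "gain (fst lT) (W \<union> T) (card T) = M"
      using lT(1) by (auto simp: P_def g_def T_def)
    have "T \<noteq> {}"
    \<comment> \<open>With \<open>T\<close> empty there is no penalty, and \<open>M\<close> would be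
      the weight of a failing \<open>W\<close>, below \<open>m / 2\<close>. The competitor
      \<open>S - W\<close> with a witness of \<open>S\<close> keeps at least half of
      \<open>sum l (W \<union> S)\<close>, hence at least \<open>m / 2\<close>.\<close>
    proof
      assume "T = {}"
      have "card (Top (fst lT) W 0) = 0" "finite (Top (fst lT) W 0)"
        using Top(2) finTop finS by simp_all
      then have "M = sum (fst lT) W"
        using fst \<open>T = {}\<close> by (simp add: gain_def)
      with W(2) fst have "M < m / 2" by auto
      obtain l where l: "l \<in> \<Lambda>" "m \<le> sum l S"
        using assms(5) S by blast
      have nonneg: "0 \<le> l i" if "i \<in> W \<union> S" for i
        using that assms(3) l W finS by auto
      have "sum l (Top l (W \<union> (S - W)) (2 * card (S - W))) \<le> sum l (W \<union> S)"
        using Top(1)[of "W \<union> (S - W)"] finS nonneg by (intro sum_mono2) auto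
      moreover have "sum l S \<le> sum l (W \<union> S)"
        using finS nonneg by (intro sum_mono2) auto
      ultimately have "m / 2 \<le> gain l (W \<union> (S - W)) (card (S - W))"
        using l by (simp add: gain_def)
      also have "\<dots> \<le> M"
        using l by (intro le_M) auto
      finally show False
        using \<open>M < m / 2\<close> by simp
    qed
    define Z where "Z = W \<union> T"
    define l where "l = best Z (card T)"
    have Z: "finite Z" "Z \<subseteq> X"
      using finS T W finite_subset[of T S] by (auto simp: Z_def)
    have finT: "finite T"
      using T finS by (auto intro: finite_subset)
    \<comment> \<open>The functional paired with \<open>T\<close> may differ from
      \<open>best Z (card T)\<close>, but the gain of the latter is at least as large, so it can
      take over.\<close>
    have l: "l \<in> \<Lambda>" "M \<le> gain l Z (card T)"
      using best fst by (auto simp: l_def Z_def)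
    have "T \<subseteq> Q Z (card T)"
    proof (rule ccontr)
      assume not_sub: "\<not> T \<subseteq> Q Z (card T)"
      define R where "R = Q Z (card T)"
      have R: "R = Top l Z (2 * card T)"
        by (simp add: R_def Q_def l_def)
      have RZ: "R \<subseteq> Z" "finite R"
        using R Top(1) finTop Z by simp_all
      have "R \<noteq> Z"
        using not_sub by (auto simp: R_def Z_def)
      then have "card R < card Z"
        using RZ Z by (intro psubset_card_mono) auto
      \<comment> \<open>Since \<open>R \<noteq> Z\<close>, the cap \<open>card Z\<close> does not
        cut the size of the top set below \<open>2 * card T\<close>.\<close>
      then have cR: "card R = 2 * card T"
        using R Top(2)[OF Z(1), of l "2 * card T"] by simp
      then have "R \<noteq> {}"
        using \<open>T \<noteq> {}\<close> finT by auto
      define z where "z = Min (l ` R)"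
      have z_le: "z \<le> l x" if "x \<in> R" for x
        using that RZ by (auto simp: z_def)
      have "z \<in> l ` R"
        unfolding z_def using RZ \<open>R \<noteq> {}\<close> by (intro Min_in) auto
      then obtain x0 where x0: "x0 \<in> R" "l x0 = z"
        by auto
      have le_z: "l y \<le> z" if "y \<in> Z - R" for y
        using Top(3)[OF Z(1), of x0 l "2 * card T" y] that x0 R by auto
      have "0 \<le> z"
        using x0 assms(3) l RZ Z by auto
      \<comment> \<open>Dropping \<open>T - R\<close> costs at most \<open>card (T - R) * z\<close>,
        while the top sum falls by at least twice that. The gain does not decrease, so the
        minimality of \<open>T\<close> forces \<open>T - R = {}\<close>.\<close>
      define T' where "T' = T \<inter> R"
      define Z' where "Z' = W \<union> T'"
      have cT: "card T = card T' + card (T - R)"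
        unfolding T'_def using finT card_Int_Diff by blast
      have Z': "finite Z'" "Z' \<subseteq> Z"
        using finS finT by (auto simp: Z'_def T'_def Z_def)
      have "sum l Z = sum l Z' + sum l (T - R)"
      proof -
        have "Z = Z' \<union> (T - R)" "Z' \<inter> (T - R) = {}"
          using T by (auto simp: Z_def Z'_def T'_def)
        then show ?thesis
          using Z' finT by (simp add: sum.union_disjoint)
      qed
      moreover have "sum l (T - R) \<le> real (card (T - R)) * z"
        using le_z by (intro sum_bounded_above) (auto simp: Z_def)
      moreover have "sum l (Top l Z' (2 * card T'))
          \<le> sum l R - (real (card R) - real (2 * card T')) * z"
        using Z Z' Top(1)[OF Z'(1), of l "2 * card T'"] Top(2)[OF Z'(1), of l "2 * card T'"]
          RZ z_le le_z \<open>0 \<le> z\<close> by (intro sum_le_top_sum[of Z]) auto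
      moreover have "(real (card R) - real (2 * card T')) * z = 2 * (real (card (T - R)) * z)"
        using cR cT by simp
      ultimately have "gain l Z (card T) \<le> gain l Z' (card T')"
        unfolding gain_def R[symmetric] by (simp add: field_simps)
      then have "card T \<le> card T'"
        using l T by (intro least[of l]) (auto simp: Z'_def T'_def)
      then have "T - R = {}"
        using cT finT by simp
      then show False
        using not_sub by (auto simp: R_def)
    qed
    then show "\<exists>T. T \<subseteq> S - W \<and> T \<noteq> {} \<and> T \<subseteq> Q (W \<union> T) (card T)"
      using T \<open>T \<noteq> {}\<close> by (auto simp: Z_def)
  qed
qed

section \<open>Expected weight of the cover by fragments\<close>

text \<open>At most \<open>2 ^ (2 * t)\<close> sets lie in \<open>R t\<close>, so size
  \<open>t\<close> contributes at most \<open>(4 / 20) ^ t\<close>; the geometric series with ratio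
  \<open>1 / 5\<close>, started at \<open>t = 1\<close>, sums to \<open>1 / 4\<close>.\<close>

lemma sum_powers_fragments_le:
  fixes a :: real
  assumes "finite Z" "0 \<le> a" "a \<le> 1 / 20" "\<And>t. finite (R t) \<and> card (R t) \<le> 2 * t"
  shows "(\<Sum>T | T \<subseteq> Z \<and> T \<noteq> {} \<and> T \<subseteq> R (card T). a ^ card T) \<le> 1 / 4"
proof -
  define C where "C = {T. T \<subseteq> Z \<and> T \<noteq> {} \<and> T \<subseteq> R (card T)}"
  have C: "finite C" "card ` C \<subseteq> {1..card Z}"
  proof -
    show "finite C"
      unfolding C_def using assms by (auto intro: finite_subset[of _ "Pow Z"])
    show "card ` C \<subseteq> {1..card Z}"
    proof safe
      fix T assume "T \<in> C"
      then have "T \<subseteq> Z" "T \<noteq> {}" "finite T"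
        using assms by (auto simp: C_def intro: finite_subset)
      then show "card T \<in> {1..card Z}"
        using assms by (auto simp: card_gt_0_iff Suc_le_eq intro: card_mono)
    qed
  qed
  have "(\<Sum>T\<in>C. a ^ card T) = (\<Sum>t\<in>{1..card Z}. \<Sum>T | T \<in> C \<and> card T = t. a ^ card T)"
    using sum.group[OF C(1) _ C(2), of "\<lambda>T. a ^ card T"] by simp
  also have "\<dots> \<le> (\<Sum>t\<in>{1..card Z}. (1 / 5) ^ t)"
  proof (intro sum_mono)
    fix t
    have "card {T. T \<in> C \<and> card T = t} \<le> card (Pow (R t))"
      using assms(4) by (intro card_mono) (auto simp: C_def)
    also have "\<dots> \<le> 2 ^ (2 * t)"
      using assms(4) by (simp add: card_Pow power_increasing)
    finally have "real (card {T. T \<in> C \<and> card T = t}) \<le> real (2 ^ (2 * t))"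
      by (simp only: of_nat_le_iff)
    also have "\<dots> = 4 ^ t"
      by (simp add: power_mult)
    finally have card_le: "real (card {T. T \<in> C \<and> card T = t}) \<le> 4 ^ t" .
    have "(\<Sum>T | T \<in> C \<and> card T = t. a ^ card T) = real (card {T. T \<in> C \<and> card T = t}) * a ^ t"
      by simp
    also have "\<dots> \<le> 4 ^ t * (1 / 20) ^ t"
      using card_le assms by (intro mult_mono power_mono) auto
    also have "\<dots> = (1 / 5) ^ t"
      by (simp add: power_mult_distrib[symmetric])
    finally show "(\<Sum>T | T \<in> C \<and> card T = t. a ^ card T) \<le> (1 / 5) ^ t" .
  qed
  also have "\<dots> \<le> 1 / 4"
  proof -
    have "(\<Sum>t\<in>{1..n}. (1 / 5 :: real) ^ t) = (1 - (1 / 5) ^ n) / 4" for n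
      by (induction n) (simp_all add: algebra_simps)
    then show ?thesis by simp
  qed
  finally show ?thesis
    by (simp add: C_def)
qed

text \<open>Change variables from \<open>(W, T)\<close> to \<open>(Z, T)\<close> with
  \<open>Z = W \<union> T\<close>. Removing \<open>T\<close> from \<open>Z\<close> multiplies the
  \<open>q\<close>-weight by \<open>((1 - q) / q) ^ card T\<close>, which turns the cost
  \<open>p ^ card T\<close> into \<open>a ^ card T\<close>. For each fixed \<open>Z\<close> the
  geometric bound applies, and the weights of the \<open>Z\<close> add up to
  \<open>1\<close>.\<close>

lemma expected_fragment_weight_le:
  fixes p q :: real
  assumes "finite X" "0 \<le> p" "0 < q" "q \<le> 1" "(1 - q) * p / q \<le> 1 / 20"
    and "\<And>Z t. Z \<subseteq> X \<Longrightarrow> finite (Q Z t) \<and> card (Q Z t) \<le> 2 * t"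
  shows "(\<Sum>W\<in>Pow X. subset_weight q X W *
      (\<Sum>T | T \<subseteq> X - W \<and> T \<noteq> {} \<and> T \<subseteq> Q (W \<union> T) (card T). p ^ card T)) \<le> 1 / 4"
proof -
  define a where "a = (1 - q) * p / q"
  define H where "H W = {T. T \<subseteq> X - W \<and> T \<noteq> {} \<and> T \<subseteq> Q (W \<union> T) (card T)}" for W
  define K where "K Z = {T. T \<subseteq> Z \<and> T \<noteq> {} \<and> T \<subseteq> Q Z (card T)}" for Z
  have fin: "finite (H W)" for W
    unfolding H_def using assms(1) by (auto intro: finite_subset[of _ "Pow X"])
  have finK: "finite (K Z)" if "Z \<in> Pow X" for Z
    unfolding K_def using assms(1) that
    by (auto intro: finite_subset[of _ "Pow X"])
  have shift: "subset_weight q X (Z - T) * p ^ card T = subset_weight q X Z * a ^ card T"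
    if "Z \<subseteq> X" "T \<subseteq> Z" for Z T
  proof -
    have f: "finite Z" "finite T" "finite (X - Z)"
      using that assms(1) by (auto intro: finite_subset)
    have "card Z = card (Z - T) + card T"
      using f that by (simp add: card_Diff_subset card_mono)
    moreover have "card (X - (Z - T)) = card (X - Z) + card T"
    proof -
      have "X - (Z - T) = (X - Z) \<union> T" "(X - Z) \<inter> T = {}"
        using that by auto
      then show ?thesis
        using f by (simp add: card_Un_disjoint)
    qed
    ultimately show ?thesis
      using assms(3) by (simp add: subset_weight_def a_def power_add power_mult_distrib power_divide)
  qed
  have union: "T \<subseteq> X \<and> T \<in> K (W \<union> T) \<and> W \<union> T - T = W" if "W \<subseteq> X" "T \<in> H W" for W T
    using that by (auto simp: H_def K_def)
  have diff: "T \<subseteq> Z \<and> T \<in> H (Z - T) \<and> Z \<union> T = Z" if "Z \<subseteq> X" "T \<in> K Z" for Z T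
  proof -
    have "Z - T \<union> T = Z"
      using that by (auto simp: K_def)
    then show ?thesis
      using that by (auto simp: H_def K_def)
  qed
  have "(\<Sum>W\<in>Pow X. subset_weight q X W * (\<Sum>T\<in>H W. p ^ card T))
      = (\<Sum>(W, T)\<in>Sigma (Pow X) H. subset_weight q X W * p ^ card T)"
    using assms(1) fin by (simp add: sum_distrib_left sum.Sigma)
  also have "\<dots> = (\<Sum>(Z, T)\<in>Sigma (Pow X) K. subset_weight q X (Z - T) * p ^ card T)"
    \<comment> \<open>\<open>T\<close> is disjoint from \<open>W\<close>, so \<open>W\<close> is
      recovered as \<open>Z - T\<close>; apart from this disjointness, \<open>H W\<close> restricts
      \<open>T\<close> only through \<open>W \<union> T\<close>, as \<open>K\<close> does.\<close>
    by (rule sum.reindex_bij_witness[of _ "\<lambda>(Z, T). (Z - T, T)" "\<lambda>(W, T). (W \<union> T, T)"])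
       (auto simp: union diff dest: union diff)
  also have "\<dots> = (\<Sum>(Z, T)\<in>Sigma (Pow X) K. subset_weight q X Z * a ^ card T)"
    by (intro sum.cong refl) (auto simp: shift K_def)
  also have "\<dots> = (\<Sum>Z\<in>Pow X. subset_weight q X Z * (\<Sum>T\<in>K Z. a ^ card T))"
    using assms(1) finK by (simp add: sum_distrib_left sum.Sigma)
  also have "\<dots> \<le> (\<Sum>Z\<in>Pow X. subset_weight q X Z * (1 / 4))"
  proof (intro sum_mono mult_left_mono)
    fix Z assume "Z \<in> Pow X"
    then show "(\<Sum>T\<in>K Z. a ^ card T) \<le> 1 / 4"
      unfolding K_def using assms
      by (intro sum_powers_fragments_le) (auto simp: a_def intro: finite_subset)
    show "0 \<le> subset_weight q X Z"
      using assms by (intro subset_weight_nonneg) auto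
  qed
  also have "\<dots> = 1 / 4"
    unfolding sum_distrib_right[symmetric] sum_subset_weight[OF assms(1)] by simp
  finally show ?thesis
    by (simp add: H_def)
qed

section \<open>From failing sets to the expected supremum\<close>

text \<open>The constant is \<open>80 = 2 * 2 * 20\<close>: sets that do not fail have mass at least
  \<open>1 / 2\<close> and value at least \<open>m / 2\<close>, and thinning from density
  \<open>q\<close> to \<open>p\<close> costs a factor of at most \<open>20\<close>.\<close>

lemma Max_expectation_lower_bound:
  fixes \<Lambda> :: "('a \<Rightarrow> real) set"
  assumes X: "finite X" and p: "0 < p" "p < 1"
    and \<Lambda>: "finite \<Lambda>" "\<Lambda> \<noteq> {}" "\<And>l i. l \<in> \<Lambda> \<Longrightarrow> i \<in> X \<Longrightarrow> 0 \<le> l i"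
    and F: "F \<subseteq> Pow X" "\<And>S. S \<in> F \<Longrightarrow> \<exists>l\<in>\<Lambda>. m \<le> sum l S"
    and m: "0 \<le> m" and not_small: "\<not> p_small p X F"
  shows "m / 80 \<le> (\<Sum>A\<in>Pow X. subset_weight p X A * Max ((\<lambda>l. sum l A) ` \<Lambda>))"
proof -
  define f where "f A = Max ((\<lambda>l. sum l A) ` \<Lambda>)" for A
  \<comment> \<open>Below the cap \<open>(1 - q) * p / q\<close> equals
    \<open>(1 - 20 * p) / 20\<close>, and at the cap it is \<open>0\<close>; so it is at most
    \<open>1 / 20\<close> in both cases.\<close>
  define q where "q = min 1 (20 * p)"
  have q: "0 < q" "q \<le> 1" "p \<le> q" "q \<le> 20 * p"
    using p by (auto simp: q_def)
  have small: "(1 - q) * p / q \<le> 1 / 20"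
    using p by (auto simp: q_def min_def)
  obtain Q where Q: "\<And>Z t. Z \<subseteq> X \<Longrightarrow> finite (Q Z t) \<and> card (Q Z t) \<le> 2 * t"
    and frag: "\<And>W S. W \<subseteq> X \<Longrightarrow> \<forall>l\<in>\<Lambda>. sum l W < m / 2 \<Longrightarrow> S \<in> F \<Longrightarrow>
      \<exists>T. T \<subseteq> S - W \<and> T \<noteq> {} \<and> T \<subseteq> Q (W \<union> T) (card T)"
    using fragments_in_small_sets[of X \<Lambda> F m] assms by metis
  define H where "H W = {T. T \<subseteq> X - W \<and> T \<noteq> {} \<and> T \<subseteq> Q (W \<union> T) (card T)}" for W
  define bad where "bad = {W \<in> Pow X. \<forall>l\<in>\<Lambda>. sum l W < m / 2}"
  have nonneg: "0 \<le> subset_weight q X W" for W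
    using q by (intro subset_weight_nonneg) auto
  \<comment> \<open>For failing \<open>W\<close> the sets in \<open>H W\<close> cover
    \<open>F\<close>, and \<open>F\<close> has no cover of weight at most
    \<open>1 / 2\<close>.\<close>
  have heavy: "1 / 2 \<le> (\<Sum>T\<in>H W. p ^ card T)" if "W \<in> bad" for W
  proof -
    have W: "W \<subseteq> X" "\<forall>l\<in>\<Lambda>. sum l W < m / 2"
      using that by (auto simp: bad_def)
    have "F \<subseteq> (\<Union>T\<in>H W. upset X T)"
    proof
      fix S assume S: "S \<in> F"
      then obtain T where "T \<subseteq> S - W" "T \<noteq> {}" "T \<subseteq> Q (W \<union> T) (card T)"
        using frag[OF W S] by blast
      then show "S \<in> (\<Union>T\<in>H W. upset X T)"
        using F(1) S by (intro UN_I[of T]) (auto simp: H_def upset_def)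
    qed
    moreover have "H W \<subseteq> Pow X"
      by (auto simp: H_def)
    ultimately show ?thesis
      using not_small unfolding p_small_def by (meson linear)
  qed
  \<comment> \<open>Markov's inequality: covers of weight at least \<open>1 / 2\<close> on
    \<open>bad\<close> against a mean weight of at most \<open>1 / 4\<close>.\<close>
  have "(\<Sum>W\<in>bad. subset_weight q X W) / 2 = (\<Sum>W\<in>bad. subset_weight q X W * (1 / 2))"
    by (simp add: sum_divide_distrib)
  also have "\<dots> \<le> (\<Sum>W\<in>bad. subset_weight q X W * (\<Sum>T\<in>H W. p ^ card T))"
    using heavy nonneg by (intro sum_mono mult_left_mono) auto
  also have "\<dots> \<le> (\<Sum>W\<in>Pow X. subset_weight q X W * (\<Sum>T\<in>H W. p ^ card T))"
    using X nonneg p by (intro sum_mono2 mult_nonneg_nonneg sum_nonneg) (auto simp: bad_def)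
  also have "\<dots> \<le> 1 / 4"
    unfolding H_def using X p q small Q by (intro expected_fragment_weight_le) auto
  finally have "(\<Sum>W\<in>bad. subset_weight q X W) \<le> 1 / 2"
    by simp
  moreover have "(\<Sum>W\<in>Pow X - bad. subset_weight q X W) = 1 - (\<Sum>W\<in>bad. subset_weight q X W)"
    using X by (subst sum_diff) (auto simp: bad_def sum_subset_weight)
  ultimately have "1 / 2 \<le> (\<Sum>W\<in>Pow X - bad. subset_weight q X W)"
    by simp
  then have "m / 4 \<le> (\<Sum>W\<in>Pow X - bad. subset_weight q X W) * (m / 2)"
    using m mult_right_mono[of "1 / 2" _ "m / 2"] by simp
  also have "\<dots> = (\<Sum>W\<in>Pow X - bad. subset_weight q X W * (m / 2))"
    by (rule sum_distrib_right)
  also have "\<dots> \<le> (\<Sum>W\<in>Pow X - bad. subset_weight q X W * f W)"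
  proof (intro sum_mono mult_left_mono nonneg)
    fix W assume "W \<in> Pow X - bad"
    then obtain l where "l \<in> \<Lambda>" "m / 2 \<le> sum l W"
      by (auto simp: bad_def not_less)
    moreover from this have "sum l W \<le> f W"
      unfolding f_def using \<Lambda> by (intro Max_ge) auto
    ultimately show "m / 2 \<le> f W" by simp
  qed
  also have "\<dots> \<le> (\<Sum>W\<in>Pow X. subset_weight q X W * f W)"
  proof (intro sum_mono2 mult_nonneg_nonneg nonneg)
    fix W assume W: "W \<in> Pow X - (Pow X - bad)"
    obtain l where l: "l \<in> \<Lambda>"
      using \<Lambda> by auto
    then have "0 \<le> sum l W"
      using \<Lambda>(3) W by (intro sum_nonneg) auto
    also have "\<dots> \<le> f W"
      unfolding f_def using \<Lambda> l by (intro Max_ge) auto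
    finally show "0 \<le> f W" .
  qed (use X in auto)
  finally have "m / 4 \<le> (\<Sum>W\<in>Pow X. subset_weight q X W * f W)" .
  moreover have "1 / 20 \<le> p / q"
    using q by (simp add: field_simps)
  ultimately have "(1 / 20) * (m / 4) \<le> (p / q) * (\<Sum>W\<in>Pow X. subset_weight q X W * f W)"
    using m p q by (intro mult_mono) auto
  also have "\<dots> \<le> (\<Sum>A\<in>Pow X. subset_weight (q * (p / q)) X A * f A)"
    unfolding f_def using X \<Lambda> p q by (intro thinning_expectation_Max) auto
  finally show ?thesis
    using q by (simp add: f_def)
qed

text \<open>Bridge from real maxima over a finite subfamily to the \<open>ennreal\<close> integral:
  for finite \<open>X\<close> the integral is a weighted sum, and the maximum is attained by a
  member of \<open>\<Lambda>\<close>, hence below the supremum.\<close>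

lemma expected_sup_ge_Max_expectation:
  fixes \<Lambda> :: "('a \<Rightarrow> real) set"
  assumes "finite X" "0 \<le> p" "p \<le> 1" "finite \<Lambda>'" "\<Lambda>' \<noteq> {}" "\<Lambda>' \<subseteq> \<Lambda>"
    and "\<And>l i. l \<in> \<Lambda> \<Longrightarrow> i \<in> X \<Longrightarrow> 0 \<le> l i"
  shows "ennreal (\<Sum>A\<in>Pow X. subset_weight p X A * Max ((\<lambda>l. sum l A) ` \<Lambda>'))
       \<le> expected_sup p X \<Lambda>"
proof -
  have attained: "\<exists>l\<in>\<Lambda>'. Max ((\<lambda>l. sum l A) ` \<Lambda>') = sum l A" for A
  proof -
    have "Max ((\<lambda>l. sum l A) ` \<Lambda>') \<in> (\<lambda>l. sum l A) ` \<Lambda>'"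
      using assms by (intro Max_in) auto
    then show ?thesis by auto
  qed
  have Max_nonneg: "0 \<le> Max ((\<lambda>l. sum l A) ` \<Lambda>')" if "A \<in> Pow X" for A
  proof -
    obtain l where "l \<in> \<Lambda>'" "Max ((\<lambda>l. sum l A) ` \<Lambda>') = sum l A"
      using attained by blast
    then show ?thesis
      using assms that by (auto intro!: sum_nonneg)
  qed
  have "ennreal (\<Sum>A\<in>Pow X. subset_weight p X A * Max ((\<lambda>l. sum l A) ` \<Lambda>'))
      = (\<Sum>A\<in>Pow X. ennreal (subset_weight p X A) * ennreal (Max ((\<lambda>l. sum l A) ` \<Lambda>')))"
  proof (subst sum_ennreal[symmetric])
    show "0 \<le> subset_weight p X A * Max ((\<lambda>l. sum l A) ` \<Lambda>')" if "A \<in> Pow X" for A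
      using Max_nonneg[OF that] subset_weight_nonneg[OF assms(2,3)] by (intro mult_nonneg_nonneg)
    show "(\<Sum>A\<in>Pow X. ennreal (subset_weight p X A * Max ((\<lambda>l. sum l A) ` \<Lambda>')))
        = (\<Sum>A\<in>Pow X. ennreal (subset_weight p X A) * ennreal (Max ((\<lambda>l. sum l A) ` \<Lambda>')))"
      using Max_nonneg subset_weight_nonneg[OF assms(2,3)]
      by (intro sum.cong refl ennreal_mult) auto
  qed
  also have "\<dots> \<le> (\<Sum>A\<in>Pow X. ennreal (subset_weight p X A) * selector_sup \<Lambda> A)"
  proof (intro sum_mono mult_left_mono)
    fix A
    obtain l where "l \<in> \<Lambda>'" "Max ((\<lambda>l. sum l A) ` \<Lambda>') = sum l A"
      using attained by blast
    then show "ennreal (Max ((\<lambda>l. sum l A) ` \<Lambda>')) \<le> selector_sup \<Lambda> A"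
      unfolding selector_sup_def using assms(6) by (auto intro: SUP_upper)
  qed auto
  also have "\<dots> = expected_sup p X \<Lambda>"
    unfolding expected_sup_def random_subset_def subset_weight_def
    using assms(1) by (simp add: nn_integral_point_measure_finite)
  finally show ?thesis .
qed

theorem theorem1p2:
  "\<exists>L::real. L > 0 \<and>
     (\<forall>(p::real) (X::'a set) (\<Lambda>::('a \<Rightarrow> real) set).
        0 < p \<longrightarrow> p < 1 \<longrightarrow> finite X \<longrightarrow>
        (\<forall>l\<in>\<Lambda>. \<forall>i\<in>X. 0 \<le> l i) \<longrightarrow>
        0 < expected_sup p X \<Lambda> \<longrightarrow> expected_sup p X \<Lambda> < \<infinity> \<longrightarrow>
        p_small p X {S. S \<subseteq> X \<and> selector_sup \<Lambda> S \<ge> ennreal L * expected_sup p X \<Lambda>})"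
\<comment> \<open>The value \<open>200\<close> leaves room twice: a witness of value
  \<open>100 * e\<close> exists although the supremum need not be attained, and
  \<open>100 * e / 80\<close> still exceeds \<open>e\<close>.\<close>
proof (intro exI[of _ 200] conjI allI impI)
  fix p :: real and X :: "'a set" and \<Lambda> :: "('a \<Rightarrow> real) set"
  assume p: "0 < p" "p < 1" and X: "finite X" and nonneg: "\<forall>l\<in>\<Lambda>. \<forall>i\<in>X. 0 \<le> l i"
    and E: "0 < expected_sup p X \<Lambda>" "expected_sup p X \<Lambda> < \<infinity>"
  define F where "F = {S. S \<subseteq> X \<and> selector_sup \<Lambda> S \<ge> ennreal 200 * expected_sup p X \<Lambda>}"
  obtain e where e: "0 < e" "expected_sup p X \<Lambda> = ennreal e"
    using E by (cases "expected_sup p X \<Lambda>") (auto simp: ennreal_zero_less_top)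
  have "\<exists>l\<in>\<Lambda>. 100 * e \<le> sum l S" if "S \<in> F" for S
  proof -
    have "ennreal (100 * e) < ennreal (200 * e)"
      using e by (simp add: ennreal_less_iff)
    also have "\<dots> \<le> selector_sup \<Lambda> S"
      using that e by (simp add: F_def ennreal_mult)
    finally obtain l where "l \<in> \<Lambda>" "ennreal (100 * e) < ennreal (sum l S)"
      unfolding selector_sup_def less_SUP_iff by auto
    then show ?thesis
      using e by (intro bexI[of _ l]) (auto simp: ennreal_less_iff)
  qed
  \<comment> \<open>As \<open>F\<close> is finite, one witness per set replaces
    \<open>\<Lambda>\<close> by a finite subfamily, over which maxima exist.\<close>
  then obtain w where w: "\<And>S. S \<in> F \<Longrightarrow> w S \<in> \<Lambda> \<and> 100 * e \<le> sum (w S) S"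
    by metis
  have finF: "finite F" "F \<subseteq> Pow X"
    unfolding F_def using X by (auto intro: finite_subset[of _ "Pow X"])
  show "p_small p X {S. S \<subseteq> X \<and> selector_sup \<Lambda> S \<ge> ennreal 200 * expected_sup p X \<Lambda>}"
    unfolding F_def[symmetric]
  proof (rule ccontr)
    assume not_small: "\<not> p_small p X F"
    have "F \<noteq> {}"
    proof
      assume "F = {}"
      then have "p_small p X F"
        unfolding p_small_def by (intro exI[of _ "{}"]) auto
      with not_small show False by simp
    qed
    have "(100 * e) / 80 \<le> (\<Sum>A\<in>Pow X. subset_weight p X A * Max ((\<lambda>l. sum l A) ` w ` F))"
    proof (rule Max_expectation_lower_bound[where F = F])
      show "\<exists>l\<in>w ` F. 100 * e \<le> sum l S" if "S \<in> F" for S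
        using w that by blast
    qed (use X p finF \<open>F \<noteq> {}\<close> w nonneg e not_small in auto)
    then have "ennreal ((100 * e) / 80)
        \<le> ennreal (\<Sum>A\<in>Pow X. subset_weight p X A * Max ((\<lambda>l. sum l A) ` w ` F))"
      by (rule ennreal_leI)
    also have "\<dots> \<le> ennreal e"
      unfolding e(2)[symmetric] using X p finF \<open>F \<noteq> {}\<close> w nonneg
      by (intro expected_sup_ge_Max_expectation) auto
    finally show False
      using e by simp
  qed
qed simp

end
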